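(* Let $f,g:[-1,1]\to\mathbb{R}$ be continuous functions which are the isotropic parts of positive definite kernels on $S^\infty$, with series representations $$f(t)=\sum_{k=0}^\infty a_k(f)t^k,\qquad g(t)=\sum_{k=0}^\infty a_k(g)t^k,\qquad t\in[-1,1],$$ where all coefficients are nonnegative and both series converge at $t=1$. Then the product $fg$ is the isotropic part of a strictly positive definite kernel on $S^\infty$ if, and only if, the set $$\{k+l:\ k,l\in\mathbb{Z}_+,\ a_k(f)a_l(g)>0\}$$ contains infinitely many even and infinitely many odd integers.
   Context: $S^\infty$ is the unit sphere of the real Hilbert space $\ell_2$, with distance $|xy|=2\arccos(x\cdot y)$, where $\cdot$ is the standard inner product of $\ell_2$; thus $\cos(|xy|/2)=x\cdot y$. A continuous function $f:[-1,1]\to\mathbb{R}$ is called the isotropic part of the kernel $K(x,y)=f(\cos(|xy|/2))$, $x,y\in S^\infty$. The kernel $K$ is positive definite if $\sum_{i,j=1}^n c_ic_jK(x_i,x_j)\ge 0$ for all $n\geq 1$, all distinct points $x_1,\dots,x_n\in S^\infty$ and all real $c_1,\dots,c_n$; it is strictly positive definite if in addition the inequality is strict whenever $c_1,\dots,c_n$ are not all zero. By Schoenberg's theorem, a continuous $f$ is the isotropic part of a positive definite kernel on $S^\infty$ (equivalently, of a positive definite kernel on $S^d$ for every $d=1,2,\dots$) if and only if it has a (unique) representation $f(t)=\sum_{k\ge0}a_k(f)t^k$ with all $a_k(f)\ge0$ and the series convergent at $t=1$. $\mathbb{Z}_+$ is the set of nonnegative integers. *)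

theory Defs
  imports "HOL-Analysis.Analysis"
begin

definition ell2 :: "(nat \<Rightarrow> real) set" where
  "ell2 = {x. summable (\<lambda>i. (x i)\<^sup>2)}"

definition ell2_inner :: "(nat \<Rightarrow> real) \<Rightarrow> (nat \<Rightarrow> real) \<Rightarrow> real" where
  "ell2_inner x y = (\<Sum>i. x i * y i)"

definition ell2_norm :: "(nat \<Rightarrow> real) \<Rightarrow> real" where
  "ell2_norm x = sqrt (ell2_inner x x)"

definition sphere_infty :: "(nat \<Rightarrow> real) set" where
  "sphere_infty = {x \<in> ell2. ell2_norm x = 1}"

definition sphere_dist :: "(nat \<Rightarrow> real) \<Rightarrow> (nat \<Rightarrow> real) \<Rightarrow> real" where
  "sphere_dist x y = 2 * arccos (ell2_inner x y)"

text \<open>Functions on \<open>[-1,1]\<close> and kernels on the sphere are total functions in HOL;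
  all conditions below concern only their values on \<open>[-1,1]\<close> and on the sphere.\<close>

definition isotropic_part ::
    "(real \<Rightarrow> real) \<Rightarrow> ((nat \<Rightarrow> real) \<Rightarrow> (nat \<Rightarrow> real) \<Rightarrow> real) \<Rightarrow> bool" where
  "isotropic_part f K \<longleftrightarrow> continuous_on {-1..1} f \<and>
     (\<forall>x\<in>sphere_infty. \<forall>y\<in>sphere_infty. K x y = f (cos (sphere_dist x y / 2)))"

definition positive_definite_kernel :: "'a set \<Rightarrow> ('a \<Rightarrow> 'a \<Rightarrow> real) \<Rightarrow> bool" where
  "positive_definite_kernel S K \<longleftrightarrow>
     (\<forall>n\<ge>1. \<forall>x :: nat \<Rightarrow> 'a. \<forall>c :: nat \<Rightarrow> real.
        x ` {1..n} \<subseteq> S \<and> inj_on x {1..n} \<longrightarrow>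
        (\<Sum>i=1..n. \<Sum>j=1..n. c i * c j * K (x i) (x j)) \<ge> 0)"

definition strictly_positive_definite_kernel :: "'a set \<Rightarrow> ('a \<Rightarrow> 'a \<Rightarrow> real) \<Rightarrow> bool" where
  "strictly_positive_definite_kernel S K \<longleftrightarrow> positive_definite_kernel S K \<and>
     (\<forall>n\<ge>1. \<forall>x :: nat \<Rightarrow> 'a. \<forall>c :: nat \<Rightarrow> real.
        x ` {1..n} \<subseteq> S \<and> inj_on x {1..n} \<and> (\<exists>i\<in>{1..n}. c i \<noteq> 0) \<longrightarrow>
        (\<Sum>i=1..n. \<Sum>j=1..n. c i * c j * K (x i) (x j)) > 0)"

end

theory Submission
  imports Defs
begin

text \<open>Write \<open>f t * g t = (\<Sum>m. w m * t ^ m)\<close> with \<open>w\<close> the Cauchy product of the coefficients, so that the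
  quadratic form of the kernel is \<open>\<Sum>m. w m * Q m\<close> with
  \<open>Q m = (\<Sum>i j. c i * c j * (x i \<bullet> x j) ^ m) \<ge> 0\<close>.
  Along even and along odd \<open>m\<close> the sequence \<open>Q\<close> converges, and the two limits add up to
  \<open>2 * (\<Sum>i. (c i)\<^sup>2) > 0\<close>; hence \<open>Q m > 0\<close> for almost all \<open>m\<close> of one parity, which gives sufficiency.
  Conversely, if \<open>w m > 0\<close> for only finitely many \<open>m\<close> of one parity, choose \<open>N\<close> of that parity beyond all of
  them and put the weights \<open>(-1) ^ j\<close> on the vertices of a regular \<open>2 * N\<close>-gon on a great circle. The weights
  are the character of frequency \<open>N\<close> of the cyclic group of order \<open>2 * N\<close>, whereas \<open>cos \<theta> ^ m\<close> only involves
  frequencies of absolute value at most \<open>m\<close> and of the parity of \<open>m\<close>. So \<open>Q m = 0\<close> whenever \<open>w m > 0\<close>.\<close>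

section \<open>Inner products of unit vectors in the sequence space\<close>

lemma ell2_inner_sums:
  assumes "x \<in> ell2" "y \<in> ell2"
  shows "(\<lambda>i. x i * y i) sums ell2_inner x y"
proof -
  have "summable (\<lambda>i. (x i)\<^sup>2 + (y i)\<^sup>2)"
    using assms by (auto simp: ell2_def intro: summable_add)
  moreover have "norm (x i * y i) \<le> (x i)\<^sup>2 + (y i)\<^sup>2" for i
  proof -
    have "\<bar>x i\<bar> * \<bar>y i\<bar> \<le> (x i)\<^sup>2 + (y i)\<^sup>2"
      using sum_squares_bound[of "\<bar>x i\<bar>" "\<bar>y i\<bar>"] mult_nonneg_nonneg[of "\<bar>x i\<bar>" "\<bar>y i\<bar>"]
      unfolding power2_abs by linarith
    then show ?thesis by (simp add: abs_mult)
  qed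
  ultimately have "summable (\<lambda>i. x i * y i)"
    by (rule summable_comparison_test'[where N = 0])
  then show ?thesis
    unfolding ell2_inner_def by (rule summable_sums)
qed

lemma sphere_infty_sums_square:
  assumes "x \<in> sphere_infty"
  shows "(\<lambda>i. (x i)\<^sup>2) sums 1"
  using assms ell2_inner_sums[of x x]
  by (auto simp: sphere_infty_def ell2_norm_def power2_eq_square)

text \<open>Here \<open>\<epsilon>\<close> is 1 or -1, so this expands the squared norms of
  \<open>x + y\<close> and \<open>x - y\<close> at once. Their nonnegativity gives the
  Cauchy-Schwarz bound; vanishing of the second gives its equality case.\<close>

lemma sphere_infty_sums_add_scaled:
  assumes "x \<in> sphere_infty" "y \<in> sphere_infty" "\<epsilon>\<^sup>2 = 1"
  shows "(\<lambda>i. (x i + \<epsilon> * y i)\<^sup>2) sums (2 + 2 * \<epsilon> * ell2_inner x y)"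
proof -
  have "(\<lambda>i. x i * y i) sums ell2_inner x y"
    using assms by (intro ell2_inner_sums) (auto simp: sphere_infty_def)
  then have "(\<lambda>i. (x i)\<^sup>2 + (2 * \<epsilon>) * (x i * y i) + (y i)\<^sup>2) sums (1 + (2 * \<epsilon>) * ell2_inner x y + 1)"
    using assms by (intro sums_add sums_mult sphere_infty_sums_square)
  moreover have "(x i + \<epsilon> * y i)\<^sup>2 = (x i)\<^sup>2 + (2 * \<epsilon>) * (x i * y i) + (y i)\<^sup>2" for i
    using assms(3) by (simp add: power2_sum power_mult_distrib)
  ultimately show ?thesis by simp
qed

lemma abs_ell2_inner_le_1:
  assumes "x \<in> sphere_infty" "y \<in> sphere_infty"
  shows "\<bar>ell2_inner x y\<bar> \<le> 1"
proof -
  have "2 + 2 * \<epsilon> * ell2_inner x y \<ge> 0" if "\<epsilon>\<^sup>2 = 1" for \<epsilon> :: real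
    using sums_le[OF _ sums_zero sphere_infty_sums_add_scaled[OF assms that]] by simp
  from this[of 1] this[of "-1"] show ?thesis by auto
qed

lemma ell2_inner_eq_1_iff:
  assumes "x \<in> sphere_infty" "y \<in> sphere_infty"
  shows "ell2_inner x y = 1 \<longleftrightarrow> x = y"
proof
  assume "ell2_inner x y = 1"
  then have s: "(\<lambda>i. (x i - y i)\<^sup>2) sums 0"
    using sphere_infty_sums_add_scaled[OF assms, of "-1"] by simp
  then have "\<forall>i. (x i - y i)\<^sup>2 = 0"
    using suminf_eq_zero_iff[OF sums_summable[OF s]] sums_unique[OF s] by simp
  then show "x = y" by (auto simp: fun_eq_iff)
next
  assume "x = y"
  then show "ell2_inner x y = 1"
    using sums_unique[OF sphere_infty_sums_square[OF assms(1)]]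
    by (simp add: ell2_inner_def power2_eq_square)
qed

lemma cos_half_sphere_dist:
  assumes "x \<in> sphere_infty" "y \<in> sphere_infty"
  shows "cos (sphere_dist x y / 2) = ell2_inner x y"
  using abs_ell2_inner_le_1[OF assms] by (simp add: sphere_dist_def)

section \<open>Quadratic forms of powers of the inner product\<close>

text \<open>A Schur product argument: one factor of the power is expanded over the coordinates
  \<open>s\<close>, and \<open>x i s\<close> is absorbed into the weight \<open>c i\<close>. Each
  coordinate then contributes a form of degree \<open>m\<close>, which is why the induction runs
  over all weights.\<close>

lemma ell2_inner_power_form_nonneg:
  assumes "finite A" "x ` A \<subseteq> ell2"
  shows "(\<Sum>i\<in>A. \<Sum>j\<in>A. c i * c j * ell2_inner (x i) (x j) ^ m) \<ge> 0"
proof (induction m arbitrary: c)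
  case 0
  have "(\<Sum>i\<in>A. \<Sum>j\<in>A. c i * c j) = (\<Sum>i\<in>A. c i)\<^sup>2"
    by (simp add: power2_eq_square sum_product)
  then show ?case by simp
next
  case (Suc m)
  define r where "r i j = ell2_inner (x i) (x j)" for i j
  have sums: "(\<lambda>s. \<Sum>i\<in>A. \<Sum>j\<in>A. (c i * c j * r i j ^ m) * (x i s * x j s)) sums
        (\<Sum>i\<in>A. \<Sum>j\<in>A. (c i * c j * r i j ^ m) * r i j)"
    unfolding r_def using assms
    by (intro sums_sum sums_mult ell2_inner_sums) auto
  have nonneg: "0 \<le> (\<Sum>i\<in>A. \<Sum>j\<in>A. (c i * c j * r i j ^ m) * (x i s * x j s))" for s
    using Suc.IH[of "\<lambda>i. c i * x i s"] by (simp add: r_def mult_ac)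
  have "0 \<le> (\<Sum>i\<in>A. \<Sum>j\<in>A. (c i * c j * r i j ^ m) * r i j)"
    by (rule sums_le[OF nonneg sums_zero sums])
  then show ?case by (simp add: r_def mult_ac)
qed

text \<open>Only even exponents are taken, since the powers of -1 have no limit along all
  exponents.\<close>

lemma power_double_tendsto:
  fixes r :: real
  assumes "\<bar>r\<bar> \<le> 1"
  shows "(\<lambda>k. r ^ (2 * k)) \<longlonglongrightarrow> (if \<bar>r\<bar> = 1 then 1 else 0)"
proof (cases "\<bar>r\<bar> = 1")
  case True
  then have "r\<^sup>2 = 1" by (metis power2_abs one_power2)
  then show ?thesis using True by (simp add: power_mult)
next
  case False
  then have "\<bar>r\<bar>\<^sup>2 < 1" using assms by (intro power_less_one_iff[THEN iffD2]) auto
  then have "(\<lambda>k. (r\<^sup>2) ^ k) \<longlonglongrightarrow> 0" by (intro LIMSEQ_power_zero) simp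
  then show ?thesis using False by (simp add: power_mult)
qed

lemma eventually_pos_infinite:
  fixes Q :: "nat \<Rightarrow> real"
  assumes "(\<lambda>k. Q (2 * k + e)) \<longlonglongrightarrow> L" "L > 0"
    and "infinite {m \<in> S. m mod 2 = e}"
  shows "\<exists>m\<in>S. Q m > 0"
proof -
  obtain k0 where k0: "\<And>k. k \<ge> k0 \<Longrightarrow> Q (2 * k + e) > 0"
    using order_tendstoD(1)[OF assms(1,2)] by (auto simp: eventually_sequentially)
  obtain m where m: "m > 2 * k0 + e" "m \<in> S" "m mod 2 = e"
    using assms(3) unfolding infinite_nat_iff_unbounded by blast
  then have "Q (2 * (m div 2) + e) > 0" by (intro k0) linarith
  moreover have "2 * (m div 2) + e = m" using mult_div_mod_eq[of 2 m] m(3) by simp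
  ultimately show ?thesis using m by auto
qed

lemma inner_power_form_pos:
  fixes x :: "'b \<Rightarrow> nat \<Rightarrow> real" and c :: "'b \<Rightarrow> real"
  assumes "finite A" "x ` A \<subseteq> sphere_infty" "inj_on x A" "\<exists>i\<in>A. c i \<noteq> 0"
    and "infinite {m \<in> S. even m}" "infinite {m \<in> S. odd m}"
  shows "\<exists>m\<in>S. (\<Sum>i\<in>A. \<Sum>j\<in>A. c i * c j * ell2_inner (x i) (x j) ^ m) > 0"
proof -
  define r where "r i j = ell2_inner (x i) (x j)" for i j
  define Q where "Q m = (\<Sum>i\<in>A. \<Sum>j\<in>A. c i * c j * r i j ^ m)" for m
  \<comment> \<open>\<open>u t\<close> is the limit of the even powers of \<open>t\<close>; odd
    powers carry one more factor \<open>t\<close>. Hence \<open>L0\<close> and \<open>L1\<close> are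
    the limits of \<open>Q\<close> along even and odd exponents.\<close>
  define u where "u t = (if \<bar>t\<bar> = 1 then 1 else 0 :: real)" for t :: real
  define L0 where "L0 = (\<Sum>i\<in>A. \<Sum>j\<in>A. c i * c j * u (r i j))"
  define L1 where "L1 = (\<Sum>i\<in>A. \<Sum>j\<in>A. c i * c j * (r i j * u (r i j)))"
  have r: "\<bar>r i j\<bar> \<le> 1" if "i \<in> A" "j \<in> A" for i j
    unfolding r_def using assms(2) that by (intro abs_ell2_inner_le_1) auto
  have Q0: "(\<lambda>k. Q (2 * k + 0)) \<longlonglongrightarrow> L0"
    unfolding Q_def L0_def u_def add_0_right
    by (intro tendsto_sum tendsto_mult tendsto_const power_double_tendsto r)
  have "(\<lambda>k. \<Sum>i\<in>A. \<Sum>j\<in>A. c i * c j * (r i j * r i j ^ (2 * k))) \<longlonglongrightarrow> L1"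
    unfolding L1_def u_def
    by (intro tendsto_sum tendsto_mult tendsto_const power_double_tendsto r)
  then have Q1: "(\<lambda>k. Q (2 * k + 1)) \<longlonglongrightarrow> L1" by (simp add: Q_def)
  \<comment> \<open>Antipodal pairs, with \<open>r i j = -1\<close>, contribute opposite amounts to
    the two limits and cancel in the sum. Distinct points never have inner product 1, so only the
    diagonal survives.\<close>
  have "c i * c j * u (r i j) + c i * c j * (r i j * u (r i j)) = (if i = j then 2 * (c i)\<^sup>2 else 0)"
    if "i \<in> A" "j \<in> A" for i j
  proof -
    have "r i j = 1 \<longleftrightarrow> x i = x j"
      unfolding r_def using assms(2) that by (intro ell2_inner_eq_1_iff) auto
    also have "\<dots> \<longleftrightarrow> i = j" using assms(3) that by (auto dest: inj_onD)
    finally have "r i j = 1 \<longleftrightarrow> i = j" .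
    then show ?thesis by (auto simp: u_def abs_if power2_eq_square)
  qed
  then have "L0 + L1 = (\<Sum>i\<in>A. \<Sum>j\<in>A. if i = j then 2 * (c i)\<^sup>2 else 0)"
    unfolding L0_def L1_def sum.distrib[symmetric] by (intro sum.cong refl) auto
  also have "\<dots> = (\<Sum>i\<in>A. 2 * (c i)\<^sup>2)"
    using assms(1) by simp
  also have "\<dots> > 0"
    using assms(1,4) by (auto intro: sum_pos2)
  finally have "L0 > 0 \<or> L1 > 0" by linarith
  then have "\<exists>m\<in>S. Q m > 0"
    using eventually_pos_infinite[OF Q0, of S] eventually_pos_infinite[OF Q1, of S] assms(5,6)
    by (auto simp: even_iff_mod_2_eq_zero odd_iff_mod_2_eq_one)
  then show ?thesis by (simp add: Q_def r_def)
qed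

section \<open>Alternating weights on a regular polygon\<close>

text \<open>Writing -1 as \<open>cis pi\<close> shifts the frequency from \<open>k\<close> to
  \<open>k + N\<close>. The terms become powers of a \<open>2 * N\<close>-th root of unity
  \<open>z\<close>, and the divisibility condition says \<open>z \<noteq> 1\<close>, so the
  geometric sum vanishes.\<close>

lemma sum_alternating_cis_eq_0:
  fixes N :: nat and k :: int
  assumes "N > 0" "\<not> 2 * int N dvd k + int N"
  shows "(\<Sum>j=1..2*N. (-1) ^ j * cis (of_int k * (pi * real j / real N))) = 0"
proof -
  define z where "z = cis (pi * of_int (k + int N) / real N)"
  have z: "(-1) ^ j * cis (of_int k * (pi * real j / real N)) = z ^ j" for j
  proof -
    have "z = cis (pi * of_int k / real N) * cis pi"
      unfolding z_def cis_mult using assms(1) by (simp add: field_simps)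
    then have "z ^ j = (-1) ^ j * cis (pi * of_int k / real N) ^ j"
      by (simp only: power_mult_distrib cis_pi mult.commute)
    also have "cis (pi * of_int k / real N) ^ j = cis (of_int k * (pi * real j / real N))"
      unfolding Complex.DeMoivre by (rule arg_cong[where f = cis]) simp
    finally show ?thesis by (rule sym)
  qed
  have "z ^ (2 * N) = cis (2 * pi * of_int (k + int N))"
    unfolding z_def Complex.DeMoivre using assms(1) by (intro arg_cong[where f = cis]) simp
  then have pow: "z ^ (2 * N) = 1" by (simp add: cis_multiple_2pi)
  have "z \<noteq> 1"
  proof
    assume "z = 1"
    then have "cos (pi * of_int (k + int N) / real N) = 1"
      by (simp add: z_def complex_eq_iff)
    then obtain l :: int where "pi * of_int (k + int N) / real N = of_int l * 2 * pi"
      using cos_one_2pi_int by blast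
    then have "pi * (of_int (k + int N) / real N) = pi * (2 * of_int l)"
      by (simp add: mult_ac)
    then have "of_int (k + int N) / real N = 2 * of_int l"
      unfolding mult_cancel_left by simp
    then have "real_of_int (k + int N) = real_of_int (2 * int N * l)"
      using assms(1) by (simp add: field_simps)
    then have "k + int N = 2 * int N * l" by (simp only: of_int_eq_iff)
    then show False using assms(2) by simp
  qed
  have "(\<Sum>j=1..2*N. z ^ j) = z * (\<Sum>j<2*N. z ^ j)"
    by (simp add: sum.atLeast1_atMost_eq sum_distrib_left)
  also have "\<dots> = 0"
    using \<open>z \<noteq> 1\<close> pow by (simp add: geometric_sum)
  finally show ?thesis by (simp only: z)
qed

lemma of_real_cos_power:
  "complex_of_real (cos t ^ m) =
     (\<Sum>s\<le>m. of_nat (m choose s) / 2 ^ m * cis (of_int (2 * int s - int m) * t))"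
proof -
  have "complex_of_real (cos t) = (cis t + cis (- t)) / 2"
    by (simp add: complex_eq_iff)
  then have "complex_of_real (cos t ^ m) = (cis t + cis (- t)) ^ m / 2 ^ m"
    by (simp only: of_real_power power_divide)
  also have "\<dots> = (\<Sum>s\<le>m. of_nat (m choose s) * cis t ^ s * cis (- t) ^ (m - s)) / 2 ^ m"
    by (simp add: binomial_ring)
  also have "\<dots> = (\<Sum>s\<le>m. of_nat (m choose s) / 2 ^ m * cis (of_int (2 * int s - int m) * t))"
    unfolding sum_divide_distrib
  proof (rule sum.cong)
    fix s assume "s \<in> {..m}"
    then have "cis t ^ s * cis (- t) ^ (m - s) = cis (of_int (2 * int s - int m) * t)"
      unfolding Complex.DeMoivre cis_mult
      by (intro arg_cong[where f = cis]) (simp add: of_nat_diff algebra_simps)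
    then show "of_nat (m choose s) * cis t ^ s * cis (- t) ^ (m - s) / 2 ^ m =
        of_nat (m choose s) / 2 ^ m * cis (of_int (2 * int s - int m) * t)"
      by (simp add: mult.assoc)
  qed simp
  finally show ?thesis .
qed

text \<open>Each frequency \<open>k s\<close> in the binomial expansion of
  \<open>cos (\<theta> i - \<theta> j) ^ m\<close> separates the two indices, so the double sum is a
  combination of products \<open>E (k s) * E (- k s)\<close>. It suffices that the first factor
  always vanishes.\<close>

lemma alternating_cos_power_form_eq_0:
  fixes N m :: nat
  assumes "N > 0" "odd (N + m) \<or> m < N"
  defines "\<theta> \<equiv> \<lambda>j. pi * real j / real N"
  shows "(\<Sum>i=1..2*N. \<Sum>j=1..2*N. (-1) ^ i * (-1) ^ j * cos (\<theta> i - \<theta> j) ^ m) = 0"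
proof -
  define C where "C s = (of_nat (m choose s) / 2 ^ m :: complex)" for s
  define k where "k s = 2 * int s - int m" for s
  define E where "E l = (\<Sum>j=1..2*N. (-1) ^ j * cis (of_int l * \<theta> j))" for l
  have E: "E (k s) = 0" if "s \<le> m" for s
    unfolding E_def \<theta>_def
  proof (rule sum_alternating_cis_eq_0[OF assms(1)], rule notI)
    assume dvd: "2 * int N dvd k s + int N"
    from assms(2) show False
    proof
      assume "odd (N + m)"
      \<comment> \<open>\<open>k s\<close> has the parity of \<open>m\<close>, so this would make
        \<open>N + m\<close> even.\<close>
      moreover have "even (k s + int N)" using dvd by (rule dvd_mult_left)
      ultimately show False by (simp add: k_def)
    next
      assume "m < N"
      \<comment> \<open>\<open>k s\<close> lies between \<open>- m\<close> and \<open>m\<close>, so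
        the shifted frequency falls strictly between consecutive multiples of
        \<open>2 * N\<close>.\<close>
      then have "0 < k s + int N" "k s + int N < 2 * int N"
        using that by (auto simp: k_def)
      then show False using zdvd_not_zless[OF _ _] dvd by blast
    qed
  qed
  have "complex_of_real (\<Sum>i=1..2*N. \<Sum>j=1..2*N. (-1) ^ i * (-1) ^ j * cos (\<theta> i - \<theta> j) ^ m) =
      (\<Sum>i=1..2*N. \<Sum>j=1..2*N. \<Sum>s\<le>m.
         C s * (((-1) ^ i * cis (of_int (k s) * \<theta> i)) * ((-1) ^ j * cis (of_int (- k s) * \<theta> j))))"
  proof -
    have "complex_of_real ((-1) ^ i * (-1) ^ j * cos (\<theta> i - \<theta> j) ^ m) = (\<Sum>s\<le>m.
         C s * (((-1) ^ i * cis (of_int (k s) * \<theta> i)) * ((-1) ^ j * cis (of_int (- k s) * \<theta> j))))" for i j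
    proof -
      have "cis (of_int (k s) * (\<theta> i - \<theta> j)) = cis (of_int (k s) * \<theta> i) * cis (of_int (- k s) * \<theta> j)" for s
        by (simp add: cis_mult algebra_simps)
      then show ?thesis
        unfolding of_real_mult of_real_cos_power
        by (simp add: C_def k_def sum_distrib_left mult_ac)
    qed
    then show ?thesis by simp
  qed
  also have "\<dots> = (\<Sum>s\<le>m. \<Sum>i=1..2*N. \<Sum>j=1..2*N.
         C s * (((-1) ^ i * cis (of_int (k s) * \<theta> i)) * ((-1) ^ j * cis (of_int (- k s) * \<theta> j))))"
    by (subst sum.swap[of _ _ "{..m}"], subst sum.swap[of _ "{..m}"]) simp
  also have "\<dots> = (\<Sum>s\<le>m. C s * (E (k s) * E (- k s)))"
    unfolding E_def sum_product by (simp only: sum_distrib_left)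
  also have "\<dots> = 0" using E by simp
  finally show ?thesis by (simp only: of_real_eq_0_iff)
qed

definition circle_point :: "real \<Rightarrow> nat \<Rightarrow> real" where
  "circle_point t = (\<lambda>i. if i = 0 then cos t else if i = 1 then sin t else 0)"

lemma ell2_inner_circle_point: "ell2_inner (circle_point s) (circle_point t) = cos (s - t)"
proof -
  have "ell2_inner (circle_point s) (circle_point t) = (\<Sum>i\<in>{0,1}. circle_point s i * circle_point t i)"
    unfolding ell2_inner_def by (rule suminf_finite) (auto simp: circle_point_def)
  then show ?thesis by (simp add: circle_point_def cos_diff)
qed

lemma circle_point_in_sphere_infty: "circle_point t \<in> sphere_infty"
proof -
  have "summable (\<lambda>i. (circle_point t i)\<^sup>2)"
    by (rule summable_finite[of "{0,1}"]) (auto simp: circle_point_def)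
  then show ?thesis
    by (simp add: sphere_infty_def ell2_def ell2_norm_def ell2_inner_circle_point)
qed

lemma inj_on_circle_point_polygon:
  "inj_on (\<lambda>j. circle_point (pi * real j / real N)) {1..2*N}"
proof (rule inj_onI)
  fix i j
  assume ij: "i \<in> {1..2*N}" "j \<in> {1..2*N}"
    and eq: "circle_point (pi * real i / real N) = circle_point (pi * real j / real N)"
  have N: "N > 0" using ij by auto
  have "sin (pi * real i / real N) = sin (pi * real j / real N) \<and>
        cos (pi * real i / real N) = cos (pi * real j / real N)"
    using fun_cong[OF eq, of 0] fun_cong[OF eq, of 1] by (simp add: circle_point_def)
  then obtain l :: int where "pi * real i / real N = pi * real j / real N + 2 * pi * of_int l"
    unfolding sin_cos_eq_iff by blast
  then have "pi * (real i / real N) = pi * (real j / real N + 2 * of_int l)"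
    by (simp add: algebra_simps)
  then have "real i / real N = real j / real N + 2 * of_int l"
    unfolding mult_cancel_left by simp
  then have "real_of_int (int i) = real_of_int (int j + 2 * int N * l)"
    using N by (simp add: field_simps)
  then have l: "int i = int j + 2 * int N * l" by (simp only: of_int_eq_iff)
  then have "2 * int N dvd int i - int j" by simp
  moreover have "\<bar>int i - int j\<bar> < 2 * int N" using ij by auto
  ultimately have "int i - int j = 0" using dvd_imp_le_int[of "int i - int j" "2 * int N"] by linarith
  then show "i = j" by simp
qed

section \<open>Strict positive definiteness read off the power series\<close>

lemma sums_power_form:
  fixes h :: "real \<Rightarrow> real"
  assumes "\<And>t. t \<in> {-1..1} \<Longrightarrow> (\<lambda>m. w m * t ^ m) sums h t"
    and "\<And>i j. i \<in> A \<Longrightarrow> j \<in> A \<Longrightarrow> \<bar>r i j\<bar> \<le> 1"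
  shows "(\<lambda>m. w m * (\<Sum>i\<in>A. \<Sum>j\<in>A. c i * c j * r i j ^ m)) sums
         (\<Sum>i\<in>A. \<Sum>j\<in>A. c i * c j * h (r i j))"
proof -
  have "(\<lambda>m. \<Sum>i\<in>A. \<Sum>j\<in>A. c i * c j * (w m * r i j ^ m)) sums
         (\<Sum>i\<in>A. \<Sum>j\<in>A. c i * c j * h (r i j))"
    using assms(2) by (intro sums_sum sums_mult assms(1)) (auto simp: abs_le_iff)
  then show ?thesis by (simp add: sum_distrib_left mult_ac)
qed

text \<open>The criterion for a single power series with nonnegative coefficients, to which the
  product is reduced through its Cauchy product.\<close>

theorem strictly_positive_definite_power_series_iff:
  fixes h :: "real \<Rightarrow> real" and w :: "nat \<Rightarrow> real"
  assumes "continuous_on {-1..1} h" and "\<And>m. w m \<ge> 0"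
    and series: "\<And>t. t \<in> {-1..1} \<Longrightarrow> (\<lambda>m. w m * t ^ m) sums h t"
  shows "(\<exists>K. isotropic_part h K \<and> strictly_positive_definite_kernel sphere_infty K)
     \<longleftrightarrow> infinite {m. w m > 0 \<and> even m} \<and> infinite {m. w m > 0 \<and> odd m}"
proof (intro iffI)
  assume inf: "infinite {m. w m > 0 \<and> even m} \<and> infinite {m. w m > 0 \<and> odd m}"
  define K where "K x y = h (cos (sphere_dist x y / 2))" for x y
  have K: "K x y = h (ell2_inner x y)" if "x \<in> sphere_infty" "y \<in> sphere_infty" for x y
    using that by (simp add: K_def cos_half_sphere_dist)
  have form: "(\<lambda>m. w m * (\<Sum>i=1..n. \<Sum>j=1..n. c i * c j * ell2_inner (x i) (x j) ^ m)) sums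
        (\<Sum>i=1..n. \<Sum>j=1..n. c i * c j * K (x i) (x j))"
    if "x ` {1..n} \<subseteq> sphere_infty" for n and x :: "nat \<Rightarrow> nat \<Rightarrow> real" and c :: "nat \<Rightarrow> real"
  proof -
    have in_sphere: "x i \<in> sphere_infty" if "i \<in> {1..n}" for i
      using that \<open>x ` {1..n} \<subseteq> sphere_infty\<close> by blast
    have "(\<Sum>i=1..n. \<Sum>j=1..n. c i * c j * K (x i) (x j)) =
          (\<Sum>i=1..n. \<Sum>j=1..n. c i * c j * h (ell2_inner (x i) (x j)))"
      by (intro sum.cong refl) (simp add: K in_sphere)
    then show ?thesis
      using sums_power_form[OF series, of "{1..n}" "\<lambda>i j. ell2_inner (x i) (x j)" c]
        abs_ell2_inner_le_1[OF in_sphere in_sphere] by simp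
  qed
  have nonneg: "w m * (\<Sum>i=1..n. \<Sum>j=1..n. c i * c j * ell2_inner (x i) (x j) ^ m) \<ge> 0"
    if "x ` {1..n} \<subseteq> sphere_infty" for m n and x :: "nat \<Rightarrow> nat \<Rightarrow> real" and c :: "nat \<Rightarrow> real"
    using that assms(2)
    by (intro mult_nonneg_nonneg ell2_inner_power_form_nonneg) (auto simp: sphere_infty_def)
  have "positive_definite_kernel sphere_infty K"
    unfolding positive_definite_kernel_def
    using sums_le[OF _ sums_zero form] nonneg by blast
  moreover have "(\<Sum>i=1..n. \<Sum>j=1..n. c i * c j * K (x i) (x j)) > 0"
    if x: "x ` {1..n} \<subseteq> sphere_infty" "inj_on x {1..n}" and c: "\<exists>i\<in>{1..n}. c i \<noteq> 0"
    for n and x :: "nat \<Rightarrow> nat \<Rightarrow> real" and c :: "nat \<Rightarrow> real"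
  proof -
    obtain m where "w m > 0" "(\<Sum>i=1..n. \<Sum>j=1..n. c i * c j * ell2_inner (x i) (x j) ^ m) > 0"
      using inner_power_form_pos[OF _ x c, of "{m. w m > 0}"] inf by auto
    \<comment> \<open>All terms of the series are nonnegative, so one positive term makes the sum
      positive.\<close>
    then have "(\<Sum>m. w m * (\<Sum>i=1..n. \<Sum>j=1..n. c i * c j * ell2_inner (x i) (x j) ^ m)) > 0"
      using nonneg[OF x(1), of _ c] sums_summable[OF form[OF x(1), of c]]
      by (intro suminf_pos2[of _ m]) auto
    then show ?thesis using sums_unique[OF form[OF x(1), of c]] by simp
  qed
  ultimately have "strictly_positive_definite_kernel sphere_infty K"
    unfolding strictly_positive_definite_kernel_def by blast
  moreover have "isotropic_part h K"
    using assms(1) by (simp add: isotropic_part_def K_def)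
  ultimately show "\<exists>K. isotropic_part h K \<and> strictly_positive_definite_kernel sphere_infty K"
    by blast
next
  assume "\<exists>K. isotropic_part h K \<and> strictly_positive_definite_kernel sphere_infty K"
  then obtain K where K: "isotropic_part h K" "strictly_positive_definite_kernel sphere_infty K"
    by blast
  have inf: "infinite {m. w m > 0 \<and> m mod 2 = e}" if e: "e < 2" for e
  proof
    assume "finite {m. w m > 0 \<and> m mod 2 = e}"
    then obtain M where M: "\<And>m. w m > 0 \<Longrightarrow> m mod 2 = e \<Longrightarrow> m \<le> M"
      unfolding finite_nat_set_iff_bounded_le by blast
    \<comment> \<open>This choice has parity \<open>e\<close>, exceeds \<open>M\<close>, and is
      positive even when \<open>M\<close> and \<open>e\<close> are 0.\<close>
    define N where "N = 2 * (M + 1) + e"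
    define \<theta> where "\<theta> j = pi * real j / real N" for j :: nat
    define x where "x = (\<lambda>j. circle_point (\<theta> j))"
    have N: "N > M" "N mod 2 = e" using e by (auto simp: N_def)
    have vanish: "w m * (\<Sum>i=1..2*N. \<Sum>j=1..2*N. (-1) ^ i * (-1) ^ j * cos (\<theta> i - \<theta> j) ^ m) = 0" for m
    proof (cases "w m > 0")
      case True
      \<comment> \<open>An exponent of parity \<open>e\<close> is at most \<open>M\<close>, hence
        below \<open>N\<close>; one of the other parity makes \<open>N + m\<close> odd.\<close>
      have "odd (N + m) \<or> m < N"
      proof (cases "m mod 2 = e")
        case True
        then show ?thesis using M[OF \<open>w m > 0\<close>] N(1) by auto
      next
        case False
        then show ?thesis using N(2) by presburger
      qed
      then show ?thesis
        using alternating_cos_power_form_eq_0[of N m] N(1) by (simp add: \<theta>_def)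
    next
      case False
      then show ?thesis using assms(2)[of m] by simp
    qed
    have "(\<lambda>m. w m * (\<Sum>i=1..2*N. \<Sum>j=1..2*N. (-1) ^ i * (-1) ^ j * cos (\<theta> i - \<theta> j) ^ m)) sums
        (\<Sum>i=1..2*N. \<Sum>j=1..2*N. (-1) ^ i * (-1) ^ j * h (cos (\<theta> i - \<theta> j)))"
      by (rule sums_power_form[OF series]) simp_all
    then have "(\<Sum>i=1..2*N. \<Sum>j=1..2*N. (-1) ^ i * (-1) ^ j * h (cos (\<theta> i - \<theta> j))) = 0"
      using sums_unique2[OF _ sums_zero] by (simp only: vanish)
    moreover have "K (x i) (x j) = h (cos (\<theta> i - \<theta> j))" for i j
      using K(1) by (simp add: isotropic_part_def x_def circle_point_in_sphere_infty
          cos_half_sphere_dist ell2_inner_circle_point)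
    ultimately have "(\<Sum>i=1..2*N. \<Sum>j=1..2*N. (-1) ^ i * (-1) ^ j * K (x i) (x j)) = 0"
      by simp
    moreover have "(\<Sum>i=1..2*N. \<Sum>j=1..2*N. (-1) ^ i * (-1) ^ j * K (x i) (x j)) > 0"
    proof -
      have "x ` {1..2*N} \<subseteq> sphere_infty"
        by (auto simp: x_def circle_point_in_sphere_infty)
      moreover have "inj_on x {1..2*N}"
        using inj_on_circle_point_polygon[of N] by (simp add: x_def \<theta>_def)
      moreover have "2 * N \<ge> 1" "\<exists>i\<in>{1..2*N}. (-1) ^ i \<noteq> (0::real)" using N(1) by auto
      ultimately show ?thesis
        using K(2) unfolding strictly_positive_definite_kernel_def by blast
    qed
    ultimately show False by simp
  qed
  from inf[of 0] inf[of 1] show "infinite {m. w m > 0 \<and> even m} \<and> infinite {m. w m > 0 \<and> odd m}"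
    by (simp add: even_iff_mod_2_eq_zero odd_iff_mod_2_eq_one)
qed

text \<open>The coefficients of the product series are the convolution \<open>w\<close> of
  \<open>a\<close> and \<open>b\<close>, so it remains to identify the indices where
  \<open>w\<close> is positive.\<close>

theorem theorem3p2:
  fixes f g :: "real \<Rightarrow> real" and a b :: "nat \<Rightarrow> real"
  assumes "continuous_on {-1..1} f" and "continuous_on {-1..1} g"
    and "\<exists>K. isotropic_part f K \<and> positive_definite_kernel sphere_infty K"
    and "\<exists>K. isotropic_part g K \<and> positive_definite_kernel sphere_infty K"
    and "\<And>k. a k \<ge> 0" and "\<And>k. b k \<ge> 0"
    and "summable a" and "summable b"
    and "\<And>t. t \<in> {-1..1} \<Longrightarrow> (\<lambda>k. a k * t ^ k) sums f t"
    and "\<And>t. t \<in> {-1..1} \<Longrightarrow> (\<lambda>k. b k * t ^ k) sums g t"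
  shows "(\<exists>K. isotropic_part (\<lambda>t. f t * g t) K \<and> strictly_positive_definite_kernel sphere_infty K)
     \<longleftrightarrow> infinite {m \<in> {k + l |k l. a k * b l > 0}. even m} \<and>
         infinite {m \<in> {k + l |k l. a k * b l > 0}. odd m}"
proof -
  define w where "w m = (\<Sum>k\<le>m. a k * b (m - k))" for m
  have w_nonneg: "w m \<ge> 0" for m
    unfolding w_def by (intro sum_nonneg mult_nonneg_nonneg assms)
  have series: "(\<lambda>m. w m * t ^ m) sums (f t * g t)" if t: "t \<in> {-1..1}" for t
  proof -
    \<comment> \<open>The Cauchy product requires absolute convergence; on the whole interval,
      endpoints included, the summable coefficients themselves are a majorant.\<close>
    have abs_summable: "summable (\<lambda>k. norm (d k * t ^ k))"
      if "summable d" "\<And>k. d k \<ge> 0" for d :: "nat \<Rightarrow> real"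
    proof (rule summable_comparison_test'[OF that(1)])
      fix k :: nat
      have "\<bar>t\<bar> ^ k \<le> 1" using t by (intro power_le_one) auto
      then show "norm (norm (d k * t ^ k)) \<le> d k"
        using that(2)[of k] by (simp add: abs_mult power_abs mult_left_le)
    qed
    have "(\<Sum>k\<le>m. (a k * t ^ k) * (b (m - k) * t ^ (m - k))) = w m * t ^ m" for m
    proof -
      have "(a k * t ^ k) * (b (m - k) * t ^ (m - k)) = a k * b (m - k) * t ^ m" if "k \<le> m" for k
        using power_add[of t k "m - k"] that by simp
      then show ?thesis unfolding w_def sum_distrib_right by (intro sum.cong refl) auto
    qed
    then show ?thesis
      using Cauchy_product_sums[OF abs_summable[OF assms(7,5)] abs_summable[OF assms(8,6)]]
        sums_unique[OF assms(9)[OF t]] sums_unique[OF assms(10)[OF t]] by simp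
  qed
  \<comment> \<open>Nonnegative terms cannot cancel, so a convolution coefficient is positive as
    soon as one of its terms is.\<close>
  have "w m > 0 \<longleftrightarrow> (\<exists>k l. m = k + l \<and> a k * b l > 0)" for m
  proof
    assume "w m > 0"
    then obtain k where "k \<le> m" "a k * b (m - k) > 0"
      unfolding w_def by (meson atMost_iff linorder_not_le sum_nonpos)
    then show "\<exists>k l. m = k + l \<and> a k * b l > 0" by (metis le_add_diff_inverse)
  next
    assume "\<exists>k l. m = k + l \<and> a k * b l > 0"
    then obtain k l where "m = k + l" "a k * b l > 0" by blast
    then have "k \<le> m" "a k * b (m - k) > 0" by simp_all
    then show "w m > 0"
      unfolding w_def using assms(5,6) by (intro sum_pos2[of _ k]) auto
  qed
  then have "{m \<in> {k + l |k l. a k * b l > 0}. P m} = {m. w m > 0 \<and> P m}" for P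
    by auto
  then show ?thesis
    using strictly_positive_definite_power_series_iff[OF continuous_on_mult[OF assms(1,2)] w_nonneg series]
    by simp
qed

end
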